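(* Let $M$ be a 7-dimensional manifold with an arbitrary $G_2^*$ structure $\varphi$, let $\xi$ be a vector field on $M$ with $g_{4,3}(\xi,\xi)=-1$, and let $(\phi,\xi,\eta,g)$ be the almost paracontact metric structure induced by $\varphi$ and $\xi$. If $\xi$ is parallel (i.e. $\nabla_X\xi=0$ for all $X$), then the component $F^{W_2}$ of $\nabla\Phi$ vanishes identically.
   Context: $G_2^*$ structures: on $\mathbb{R}^7$ with standard basis $e_1,\dots,e_7$ and dual basis $e^1,\dots,e^7$, let $g_{4,3}$ be the metric of signature $(-,-,-,-,+,+,+)$ for which the basis is orthonormal (the first four vectors having square $-1$), and let $\varphi_0=-e^{127}-e^{135}+e^{146}+e^{236}+e^{245}-e^{347}+e^{567}$, where $e^{ijk}=e^i\wedge e^j\wedge e^k$. $G_2^*$ is the stabilizer of $\varphi_0$ in $GL(7,\mathbb{R})$; it preserves $g_{4,3}$. A $G_2^*$ structure on a smooth oriented 7-manifold $M$ is a smooth 3-form $\varphi$ such that $(T_pM,\varphi_p)$ is isomorphic to $(\mathbb{R}^7,\varphi_0)$ for every $p\in M$. It induces a semi-Riemannian metric, also denoted $g_{4,3}$ (transported pointwise through these isomorphisms), and a cross product $P$ defined by $\varphi(X,Y,Z)=g_{4,3}(P(X,Y),Z)$. Induced almost paracontact metric structure: given a vector field $\xi$ with $g_{4,3}(\xi,\xi)=-1$, set $\phi(X)=P(\xi,X)$, $g=-g_{4,3}$, $\eta(X)=g(\xi,X)$. Then $\phi^2=I-\eta\otimes\xi$, $\eta(\xi)=1$, $g(\phi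 X,\phi Y)=-g(X,Y)+\eta(X)\eta(Y)$. The metrics $g$ and $g_{4,3}$ have the same Levi-Civita connection $\nabla$. The fundamental 2-form is $\Phi(X,Y)=g(\phi X,Y)$ and $F(X,Y,Z)=(\nabla_X\Phi)(Y,Z)$. The component (projection) of $F$ on $W_2=\mathbb{G}_5\oplus\mathbb{G}_6\oplus\cdots\oplus\mathbb{G}_{10}$ in the classification of almost paracontact metric structures is $$F^{W_2}(X,Y,Z)=-\eta(Y)F(\phi^2X,\phi^2Z,\xi)+\eta(Z)F(\phi^2X,\phi^2Y,\xi).$$ *)

theory Defs
  imports "HOL-Analysis.Analysis"
begin

section \<open>Smooth manifolds\<close>

primrec Ck_on :: "nat \<Rightarrow> 'a::euclidean_space set \<Rightarrow> ('a \<Rightarrow> 'b::real_normed_vector) \<Rightarrow> bool" where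
  "Ck_on 0 S f \<longleftrightarrow> continuous_on S f"
| "Ck_on (Suc k) S f \<longleftrightarrow>
     (\<forall>x\<in>S. f differentiable (at x)) \<and> (\<forall>v. Ck_on k S (\<lambda>x. frechet_derivative f (at x) v))"

text \<open>Only used for open \<open>S\<close>.\<close>

definition smooth_on :: "'a::euclidean_space set \<Rightarrow> ('a \<Rightarrow> 'b::real_normed_vector) \<Rightarrow> bool" where
  "smooth_on S f \<longleftrightarrow> (\<forall>k. Ck_on k S f)"

text \<open>A chart is a pair \<open>(U, c)\<close> of its domain and its coordinate map. The manifold is the
  whole of the type \<open>'m\<close>, whose topology is that of its type class; theorems ask for
  a second countable Hausdorff space through the sort of \<open>'m\<close>.\<close>

type_synonym ('m, 'n) chart = "'m set \<times> ('m \<Rightarrow> real ^ 'n)"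
type_synonym ('m, 'n) atlas = "('m, 'n) chart set"

definition smooth_atlas :: "('m::topological_space, 'n::finite) atlas \<Rightarrow> bool" where
  "smooth_atlas A \<longleftrightarrow>
     (\<Union>(U, c)\<in>A. U) = UNIV \<and>
     (\<forall>(U, c)\<in>A. open U \<and> open (c ` U) \<and> inj_on c U \<and>
        homeomorphism U (c ` U) c (inv_into U c)) \<and>
     (\<forall>(U, c)\<in>A. \<forall>(V, d)\<in>A. smooth_on (c ` (U \<inter> V)) (d \<circ> inv_into U c))"

definition oriented_atlas :: "('m::topological_space, 'n::finite) atlas \<Rightarrow> bool" where
  "oriented_atlas A \<longleftrightarrow>
     (\<forall>(U, c)\<in>A. \<forall>(V, d)\<in>A. \<forall>x\<in>c ` (U \<inter> V).
        det (matrix (frechet_derivative (d \<circ> inv_into U c) (at x))) > 0)"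

definition smooth_fun :: "('m::topological_space, 'n::finite) atlas \<Rightarrow> ('m \<Rightarrow> real) \<Rightarrow> bool" where
  "smooth_fun A f \<longleftrightarrow> (\<forall>(U, c)\<in>A. smooth_on (c ` U) (f \<circ> inv_into U c))"

section \<open>Tangent vectors and vector fields\<close>

text \<open>Tangent vectors at \<open>p\<close> are the derivations at \<open>p\<close> of the algebra of smooth functions. They are
  normalised to \<open>0\<close> on non-smooth arguments, so that equality in HOL is equality of derivations.\<close>

type_synonym 'm tvec = "('m \<Rightarrow> real) \<Rightarrow> real"
type_synonym 'm vfield = "'m \<Rightarrow> 'm tvec"

definition tangent_space :: "('m::topological_space, 'n::finite) atlas \<Rightarrow> 'm \<Rightarrow> 'm tvec set" where
  "tangent_space A p = {v.
     (\<forall>f g. smooth_fun A f \<longrightarrow> smooth_fun A g \<longrightarrow> v (\<lambda>x. f x + g x) = v f + v g) \<and>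
     (\<forall>a f. smooth_fun A f \<longrightarrow> v (\<lambda>x. a * f x) = a * v f) \<and>
     (\<forall>f g. smooth_fun A f \<longrightarrow> smooth_fun A g \<longrightarrow> v (\<lambda>x. f x * g x) = f p * v g + g p * v f) \<and>
     (\<forall>f. \<not> smooth_fun A f \<longrightarrow> v f = 0)}"

definition tv_zero :: "'m tvec" where
  "tv_zero = (\<lambda>f. 0)"

definition tv_add :: "'m tvec \<Rightarrow> 'm tvec \<Rightarrow> 'm tvec" where
  "tv_add u v = (\<lambda>f. u f + v f)"

definition tv_scale :: "real \<Rightarrow> 'm tvec \<Rightarrow> 'm tvec" where
  "tv_scale a v = (\<lambda>f. a * v f)"

definition vector_field :: "('m::topological_space, 'n::finite) atlas \<Rightarrow> 'm vfield \<Rightarrow> bool" where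
  "vector_field A X \<longleftrightarrow>
     (\<forall>p. X p \<in> tangent_space A p) \<and>
     (\<forall>f. smooth_fun A f \<longrightarrow> smooth_fun A (\<lambda>p. X p f))"

definition lie_bracket :: "'m vfield \<Rightarrow> 'm vfield \<Rightarrow> 'm vfield" where
  "lie_bracket X Y = (\<lambda>p f. X p (\<lambda>q. Y q f) - Y p (\<lambda>q. X q f))"

section \<open>Tensor fields and the Levi-Civita connection\<close>

type_synonym 'm tensor2 = "'m \<Rightarrow> 'm tvec \<Rightarrow> 'm tvec \<Rightarrow> real"
type_synonym 'm tensor3 = "'m \<Rightarrow> 'm tvec \<Rightarrow> 'm tvec \<Rightarrow> 'm tvec \<Rightarrow> real"

text \<open>Linearity in the first argument and antisymmetry give trilinearity.\<close>

definition smooth_3form :: "('m::topological_space, 'n::finite) atlas \<Rightarrow> 'm tensor3 \<Rightarrow> bool" where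
  "smooth_3form A \<omega> \<longleftrightarrow>
     (\<forall>p. \<forall>u\<in>tangent_space A p. \<forall>v\<in>tangent_space A p. \<forall>w\<in>tangent_space A p.
        (\<forall>u'\<in>tangent_space A p. \<omega> p (tv_add u u') v w = \<omega> p u v w + \<omega> p u' v w) \<and>
        (\<forall>a. \<omega> p (tv_scale a u) v w = a * \<omega> p u v w) \<and>
        \<omega> p v u w = - \<omega> p u v w \<and>
        \<omega> p u w v = - \<omega> p u v w) \<and>
     (\<forall>X Y Z. vector_field A X \<longrightarrow> vector_field A Y \<longrightarrow> vector_field A Z \<longrightarrow>
        smooth_fun A (\<lambda>p. \<omega> p (X p) (Y p) (Z p)))"

text \<open>\<open>nabla X Y\<close> is \<open>\<nabla>\<^sub>X Y\<close>. The last clause fixes the irrelevant values at non-smooth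
  arguments, so that a metric has exactly one Levi-Civita connection as a HOL function.\<close>

definition levi_civita ::
  "('m::topological_space, 'n::finite) atlas \<Rightarrow> 'm tensor2 \<Rightarrow> ('m vfield \<Rightarrow> 'm vfield \<Rightarrow> 'm vfield) \<Rightarrow> bool"
where
  "levi_civita A g nabla \<longleftrightarrow>
     (\<forall>X Y. vector_field A X \<longrightarrow> vector_field A Y \<longrightarrow> vector_field A (nabla X Y)) \<and>
     (\<forall>X X' Y. vector_field A X \<longrightarrow> vector_field A X' \<longrightarrow> vector_field A Y \<longrightarrow>
        nabla (\<lambda>p. tv_add (X p) (X' p)) Y = (\<lambda>p. tv_add (nabla X Y p) (nabla X' Y p))) \<and>
     (\<forall>f X Y. smooth_fun A f \<longrightarrow> vector_field A X \<longrightarrow> vector_field A Y \<longrightarrow>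
        nabla (\<lambda>p. tv_scale (f p) (X p)) Y = (\<lambda>p. tv_scale (f p) (nabla X Y p))) \<and>
     (\<forall>X Y Y'. vector_field A X \<longrightarrow> vector_field A Y \<longrightarrow> vector_field A Y' \<longrightarrow>
        nabla X (\<lambda>p. tv_add (Y p) (Y' p)) = (\<lambda>p. tv_add (nabla X Y p) (nabla X Y' p))) \<and>
     (\<forall>f X Y. smooth_fun A f \<longrightarrow> vector_field A X \<longrightarrow> vector_field A Y \<longrightarrow>
        nabla X (\<lambda>p. tv_scale (f p) (Y p)) =
          (\<lambda>p. tv_add (tv_scale (X p f) (Y p)) (tv_scale (f p) (nabla X Y p)))) \<and>
     (\<forall>X Y. vector_field A X \<longrightarrow> vector_field A Y \<longrightarrow>
        (\<lambda>p. tv_add (nabla X Y p) (tv_scale (- 1) (nabla Y X p))) = lie_bracket X Y) \<and>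
     (\<forall>X Y Z p. vector_field A X \<longrightarrow> vector_field A Y \<longrightarrow> vector_field A Z \<longrightarrow>
        X p (\<lambda>q. g q (Y q) (Z q)) = g p (nabla X Y p) (Z p) + g p (Y p) (nabla X Z p)) \<and>
     (\<forall>X Y. \<not> (vector_field A X \<and> vector_field A Y) \<longrightarrow> nabla X Y = (\<lambda>p. tv_zero))"

definition cov_deriv2 ::
  "('m vfield \<Rightarrow> 'm vfield \<Rightarrow> 'm vfield) \<Rightarrow> 'm tensor2 \<Rightarrow>
   'm vfield \<Rightarrow> 'm vfield \<Rightarrow> 'm vfield \<Rightarrow> 'm \<Rightarrow> real"
where
  "cov_deriv2 nabla B X Y Z p =
     X p (\<lambda>q. B q (Y q) (Z q)) - B p (nabla X Y p) (Z p) - B p (Y p) (nabla X Z p)"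

section \<open>\<open>G\<^sub>2\<^sup>*\<close> structures\<close>

text \<open>Indices are elements of the type \<open>7\<close>, in which the numeral \<open>7\<close> denotes \<open>0\<close>; so
  \<open>1, \<dots>, 7\<close> are its seven distinct elements.\<close>

definition wedge3 :: "7 \<Rightarrow> 7 \<Rightarrow> 7 \<Rightarrow> real^7 \<Rightarrow> real^7 \<Rightarrow> real^7 \<Rightarrow> real" where
  "wedge3 i j k x y z =
     det (vector [vector [x $ i, x $ j, x $ k],
                  vector [y $ i, y $ j, y $ k],
                  vector [z $ i, z $ j, z $ k]] :: real^3^3)"

definition phi0 :: "real^7 \<Rightarrow> real^7 \<Rightarrow> real^7 \<Rightarrow> real" where
  "phi0 x y z = - wedge3 1 2 7 x y z - wedge3 1 3 5 x y z + wedge3 1 4 6 x y z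
     + wedge3 2 3 6 x y z + wedge3 2 4 5 x y z - wedge3 3 4 7 x y z + wedge3 5 6 7 x y z"

definition g0 :: "real^7 \<Rightarrow> real^7 \<Rightarrow> real" where
  "g0 x y = - x$1 * y$1 - x$2 * y$2 - x$3 * y$3 - x$4 * y$4 + x$5 * y$5 + x$6 * y$6 + x$7 * y$7"

definition g2_star_frame :: "('m::topological_space, 7) atlas \<Rightarrow> 'm tensor3 \<Rightarrow> 'm \<Rightarrow> (real^7 \<Rightarrow> 'm tvec) \<Rightarrow> bool"
where
  "g2_star_frame A \<omega> p L \<longleftrightarrow>
     bij_betw L UNIV (tangent_space A p) \<and>
     (\<forall>x y. L (x + y) = tv_add (L x) (L y)) \<and>
     (\<forall>a x. L (a *\<^sub>R x) = tv_scale a (L x)) \<and>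
     (\<forall>x y z. \<omega> p (L x) (L y) (L z) = phi0 x y z)"

definition g2_star_structure :: "('m::topological_space, 7) atlas \<Rightarrow> 'm tensor3 \<Rightarrow> bool" where
  "g2_star_structure A \<omega> \<longleftrightarrow> smooth_3form A \<omega> \<and> (\<forall>p. \<exists>L. g2_star_frame A \<omega> p L)"

text \<open>Two frames at \<open>p\<close> differ by an element of the stabiliser of \<^const>\<open>phi0\<close>, which preserves
  \<^const>\<open>g0\<close>; hence the transported metric does not depend on the frame chosen.\<close>

definition g43 :: "('m::topological_space, 7) atlas \<Rightarrow> 'm tensor3 \<Rightarrow> 'm tensor2" where
  "g43 A \<omega> p u v = (let L = (SOME L. g2_star_frame A \<omega> p L) in g0 (inv L u) (inv L v))"

definition cross_product :: "('m::topological_space, 7) atlas \<Rightarrow> 'm tensor3 \<Rightarrow> 'm \<Rightarrow> 'm tvec \<Rightarrow> 'm tvec \<Rightarrow> 'm tvec"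
where
  "cross_product A \<omega> p u v =
     (THE w. w \<in> tangent_space A p \<and> (\<forall>z\<in>tangent_space A p. \<omega> p u v z = g43 A \<omega> p w z))"

section \<open>The induced almost paracontact metric structure\<close>

definition apm_g :: "('m::topological_space, 7) atlas \<Rightarrow> 'm tensor3 \<Rightarrow> 'm tensor2" where
  "apm_g A \<omega> p u v = - g43 A \<omega> p u v"

definition apm_phi :: "('m::topological_space, 7) atlas \<Rightarrow> 'm tensor3 \<Rightarrow> 'm vfield \<Rightarrow> 'm \<Rightarrow> 'm tvec \<Rightarrow> 'm tvec"
where
  "apm_phi A \<omega> \<xi> p u = cross_product A \<omega> p (\<xi> p) u"

definition apm_eta :: "('m::topological_space, 7) atlas \<Rightarrow> 'm tensor3 \<Rightarrow> 'm vfield \<Rightarrow> 'm \<Rightarrow> 'm tvec \<Rightarrow> real"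
where
  "apm_eta A \<omega> \<xi> p u = apm_g A \<omega> p (\<xi> p) u"

definition apm_Phi :: "('m::topological_space, 7) atlas \<Rightarrow> 'm tensor3 \<Rightarrow> 'm vfield \<Rightarrow> 'm tensor2" where
  "apm_Phi A \<omega> \<xi> p u v = apm_g A \<omega> p (apm_phi A \<omega> \<xi> p u) v"

definition apm_F ::
  "('m::topological_space, 7) atlas \<Rightarrow> 'm tensor3 \<Rightarrow> 'm vfield \<Rightarrow>
   ('m vfield \<Rightarrow> 'm vfield \<Rightarrow> 'm vfield) \<Rightarrow> 'm vfield \<Rightarrow> 'm vfield \<Rightarrow> 'm vfield \<Rightarrow> 'm \<Rightarrow> real"
where
  "apm_F A \<omega> \<xi> nabla X Y Z p = cov_deriv2 nabla (apm_Phi A \<omega> \<xi>) X Y Z p"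

definition apm_F_W2 ::
  "('m::topological_space, 7) atlas \<Rightarrow> 'm tensor3 \<Rightarrow> 'm vfield \<Rightarrow>
   ('m vfield \<Rightarrow> 'm vfield \<Rightarrow> 'm vfield) \<Rightarrow> 'm vfield \<Rightarrow> 'm vfield \<Rightarrow> 'm vfield \<Rightarrow> 'm \<Rightarrow> real"
where
  "apm_F_W2 A \<omega> \<xi> nabla X Y Z p =
     (let sq = (\<lambda>V q. apm_phi A \<omega> \<xi> q (apm_phi A \<omega> \<xi> q (V q)))
      in - apm_eta A \<omega> \<xi> p (Y p) * apm_F A \<omega> \<xi> nabla (sq X) (sq Z) \<xi> p
         + apm_eta A \<omega> \<xi> p (Z p) * apm_F A \<omega> \<xi> nabla (sq X) (sq Y) \<xi> p)"

end

theory Submission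
  imports Defs
begin

text \<open>Since \<open>\<xi>\<close> is parallel, the product rule reduces \<open>(\<nabla>\<^sub>X\<Phi>)(Y, \<xi>)\<close> to terms of the form
  \<open>\<Phi>(U, \<xi>) = - \<omega>(\<xi>, U, \<xi>)\<close>, which vanish by antisymmetry; these values of \<open>F\<close> are the only ones
  that occur in its \<open>W\<^sub>2\<close>-component.

  Neither the cross product nor \<open>\<phi>\<^sup>2 X\<close> needs to be shown smooth: the argument only
  uses that \<open>\<nabla>\<^sub>V W\<close> is tangent and that \<open>\<nabla>\<^sub>V \<xi> = 0\<close>, and both remain true when \<open>V\<close> or \<open>W\<close> is not
  a smooth vector field, because the connection is then \<open>0\<close> by convention.\<close>

lemma exhaust_7: "(i::7) = 1 \<or> i = 2 \<or> i = 3 \<or> i = 4 \<or> i = 5 \<or> i = 6 \<or> i = 7"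
proof (cases i)
  case (of_int z)
  then have "z \<in> {0..<7}" by simp
  moreover have "{0..<7} = {0, 1, 2, 3, 4, 5, 6 :: int}" by auto
  \<comment> \<open>The residue \<open>z = 0\<close> gives the last disjunct, since
    \<open>7 = 0\<close> in the type \<open>7\<close>.\<close>
  ultimately show ?thesis using of_int by auto
qed

lemma UNIV_7: "(UNIV :: 7 set) = {1, 2, 3, 4, 5, 6, 7}"
  using exhaust_7 by blast

lemma sum_7: "sum f (UNIV :: 7 set) = f 1 + f 2 + f 3 + f 4 + f 5 + f 6 + f 7"
  unfolding UNIV_7 by (simp add: add.assoc)

text \<open>Pairing with the i-th standard basis vector reads off the i-th coordinate up to sign.
  This gives the uniqueness of the cross product.\<close>

lemma g0_nondegenerate:
  assumes "\<And>z. g0 w z = g0 w' z"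
  shows "w = w'"
proof -
  have "w $ i = w' $ i" if "i \<in> {1, 2, 3, 4, 5, 6, 7}" for i
    using that assms[of "axis 1 1"] assms[of "axis 2 1"] assms[of "axis 3 1"] assms[of "axis 4 1"]
      assms[of "axis 5 1"] assms[of "axis 6 1"] assms[of "axis 7 1"]
    by (elim insertE) (simp_all add: g0_def axis_def)
  then show ?thesis unfolding vec_eq_iff UNIV_7[symmetric] by simp
qed

lemma linear_g0_representable:
  fixes f :: "real^7 \<Rightarrow> real"
  assumes "linear f"
  shows "\<exists>w. \<forall>z. f z = g0 w z"
proof (intro exI allI)
  fix z
  \<comment> \<open>\<open>?a\<close> represents \<open>f\<close> for the Euclidean inner product;
    flipping its first four coordinates compensates for the negative directions of
    \<open>g0\<close>.\<close>
  let ?a = "adjoint f 1"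
  let ?w = "\<chi> i. if i \<in> {1, 2, 3, 4} then - ?a $ i else ?a $ i"
  have "f z = ?a \<bullet> z"
    using adjoint_works[OF assms, of z 1] by (simp add: inner_commute)
  then show "f z = g0 ?w z"
    by (simp add: g0_def inner_vec_def sum_7)
qed

lemma linear_phi0: "linear (phi0 x y)"
  by (rule linearI) (simp_all add: phi0_def wedge3_def det_3 algebra_simps)

text \<open>If the zero function is smooth, this is homogeneity with scalar 0; otherwise it is the
  normalisation of derivations.\<close>

lemma tangent_const_zero:
  assumes "v \<in> tangent_space A p"
  shows "v (\<lambda>x. 0) = 0"
proof (cases "smooth_fun A (\<lambda>x. 0)")
  case True
  then have "v (\<lambda>x. 0 * 0) = 0 * v (\<lambda>x. 0)"
    using assms unfolding tangent_space_def by blast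
  then show ?thesis by simp
next
  case False
  then show ?thesis using assms by (simp add: tangent_space_def)
qed

lemma g2_star_frame_zero:
  assumes "g2_star_frame A \<omega> p L"
  shows "L 0 = tv_zero"
proof -
  have "L (0 *\<^sub>R 0) = tv_scale 0 (L 0)"
    using assms by (simp only: g2_star_frame_def)
  then show ?thesis by (simp add: tv_scale_def tv_zero_def)
qed

lemma g43_frame:
  assumes "g2_star_structure A \<omega>"
  obtains L where "g2_star_frame A \<omega> p L" "\<And>x y. g43 A \<omega> p (L x) (L y) = g0 x y"
proof -
  \<comment> \<open>This is the very frame chosen inside \<open>g43\<close>, so \<open>inv L\<close>
    there cancels \<open>L\<close>.\<close>
  define L where "L = (SOME L. g2_star_frame A \<omega> p L)"
  have L: "g2_star_frame A \<omega> p L"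
    unfolding L_def using assms by (simp add: g2_star_structure_def someI_ex)
  then have "inj L" by (simp add: g2_star_frame_def bij_betw_def)
  then have "g43 A \<omega> p (L x) (L y) = g0 x y" for x y
    unfolding g43_def Let_def L_def[symmetric] by simp
  with L show thesis by (rule that)
qed

lemma tv_zero_in_tangent_space:
  assumes "g2_star_structure A \<omega>"
  shows "tv_zero \<in> tangent_space A p"
proof -
  obtain L where L: "g2_star_frame A \<omega> p L" using g43_frame[OF assms] by blast
  then have "range L = tangent_space A p" by (simp add: g2_star_frame_def bij_betw_def)
  then show ?thesis using g2_star_frame_zero[OF L] by (metis rangeI)
qed

lemma g43_zero_right:
  assumes "g2_star_structure A \<omega>" and "u \<in> tangent_space A p"
  shows "g43 A \<omega> p u tv_zero = 0"
proof -
  obtain L where L: "g2_star_frame A \<omega> p L" "\<And>x y. g43 A \<omega> p (L x) (L y) = g0 x y"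
    using g43_frame[OF assms(1)] by blast
  then have "tangent_space A p = range L" by (simp add: g2_star_frame_def bij_betw_def)
  then obtain x where "u = L x" using assms(2) by blast
  then have "g43 A \<omega> p u tv_zero = g0 x 0"
    by (metis L g2_star_frame_zero)
  then show ?thesis by (simp add: g0_def)
qed

text \<open>In a frame, the defining condition of \<open>cross_product\<close> says that a vector
  represents the functional \<open>phi0 x y\<close> through \<open>g0\<close>. Representability
  gives existence and nondegeneracy gives uniqueness, so the definite description is proper.\<close>

lemma
  assumes "g2_star_structure A \<omega>" and "u \<in> tangent_space A p" and "v \<in> tangent_space A p"
  shows cross_product_in_tangent_space: "cross_product A \<omega> p u v \<in> tangent_space A p"
    and g43_cross_product:
      "z \<in> tangent_space A p \<Longrightarrow> g43 A \<omega> p (cross_product A \<omega> p u v) z = \<omega> p u v z"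
proof -
  obtain L where L: "g2_star_frame A \<omega> p L" "\<And>x y. g43 A \<omega> p (L x) (L y) = g0 x y"
    using g43_frame[OF assms(1)] by blast
  then have T: "tangent_space A p = range L"
    and \<omega>: "\<And>x y z. \<omega> p (L x) (L y) (L z) = phi0 x y z"
    by (auto simp: g2_star_frame_def bij_betw_def)
  obtain x y where xy: "u = L x" "v = L y" using assms T by auto
  obtain w where w: "\<And>z. phi0 x y z = g0 w z" using linear_g0_representable[OF linear_phi0] by blast
  let ?P = "\<lambda>w. w \<in> tangent_space A p \<and> (\<forall>z\<in>tangent_space A p. \<omega> p u v z = g43 A \<omega> p w z)"
  have "\<exists>!w. ?P w"
  proof (rule ex1I)
    show "?P (L w)" by (auto simp: T xy \<omega> L(2) w)
    show "w' = L w" if w': "?P w'" for w'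
    proof -
      obtain a where a: "w' = L a" using w' T by blast
      have "g0 a z = g0 w z" for z
        using w' by (simp add: T xy \<omega> L(2) w a)
      then show ?thesis using a g0_nondegenerate by blast
    qed
  qed
  then have "?P (cross_product A \<omega> p u v)"
    unfolding cross_product_def by (rule theI')
  then show "cross_product A \<omega> p u v \<in> tangent_space A p"
    and "z \<in> tangent_space A p \<Longrightarrow> g43 A \<omega> p (cross_product A \<omega> p u v) z = \<omega> p u v z"
    by auto
qed

lemma apm_phi_in_tangent_space:
  assumes "g2_star_structure A \<omega>" and "vector_field A \<xi>" and "u \<in> tangent_space A p"
  shows "apm_phi A \<omega> \<xi> p u \<in> tangent_space A p"
  unfolding apm_phi_def
  using assms by (intro cross_product_in_tangent_space) (auto simp: vector_field_def)

lemma apm_Phi_xi_right: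
  assumes "g2_star_structure A \<omega>" and "vector_field A \<xi>" and u: "u \<in> tangent_space A p"
  shows "apm_Phi A \<omega> \<xi> p u (\<xi> p) = 0"
proof -
  have \<xi>: "\<xi> p \<in> tangent_space A p" using assms(2) by (simp add: vector_field_def)
  have "smooth_3form A \<omega>" using assms(1) by (simp add: g2_star_structure_def)
  then have "\<omega> p (\<xi> p) u (\<xi> p) = - \<omega> p (\<xi> p) (\<xi> p) u" "\<omega> p (\<xi> p) (\<xi> p) u = - \<omega> p (\<xi> p) (\<xi> p) u"
    unfolding smooth_3form_def using \<xi> u by blast+
  then have "\<omega> p (\<xi> p) u (\<xi> p) = 0" by linarith
  then show ?thesis
    using g43_cross_product[OF assms(1) \<xi> u \<xi>] by (simp add: apm_Phi_def apm_g_def apm_phi_def)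
qed

text \<open>\<open>Y\<close> must be tangent at every point, because \<open>X p\<close> is applied
  to the whole function \<Phi>(Y, \<xi>), which has to vanish identically and not only at
  \<open>p\<close>.\<close>

lemma apm_F_xi_right:
  assumes G: "g2_star_structure A \<omega>" and \<xi>: "vector_field A \<xi>"
    and LC: "levi_civita A (apm_g A \<omega>) nabla"
    and parallel: "\<And>X. vector_field A X \<Longrightarrow> nabla X \<xi> = (\<lambda>p. tv_zero)"
    and X: "X p \<in> tangent_space A p" and Y: "\<And>q. Y q \<in> tangent_space A q"
  shows "apm_F A \<omega> \<xi> nabla X Y \<xi> p = 0"
proof -
  have closed: "\<forall>V W. vector_field A V \<longrightarrow> vector_field A W \<longrightarrow> vector_field A (nabla V W)"
    using LC unfolding levi_civita_def by (elim conjE)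
  have conv: "\<forall>V W. \<not> (vector_field A V \<and> vector_field A W) \<longrightarrow> nabla V W = (\<lambda>p. tv_zero)"
    using LC unfolding levi_civita_def by (elim conjE)
  have tangent: "nabla X Y p \<in> tangent_space A p"
  proof (cases "vector_field A X \<and> vector_field A Y")
    case True
    then show ?thesis using closed by (simp add: vector_field_def)
  next
    case False
    then have "nabla X Y = (\<lambda>p. tv_zero)" using conv by blast
    then show ?thesis using tv_zero_in_tangent_space[OF G] by simp
  qed
  have "nabla X \<xi> p = tv_zero"
    using parallel conv by (cases "vector_field A X") auto
  then have "apm_Phi A \<omega> \<xi> p (Y p) (nabla X \<xi> p) = 0"
    using g43_zero_right[OF G apm_phi_in_tangent_space[OF G \<xi> Y]]
    by (simp add: apm_Phi_def apm_g_def)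
  then show ?thesis
    by (simp add: apm_F_def cov_deriv2_def apm_Phi_xi_right[OF G \<xi>] Y tangent
        tangent_const_zero[OF X])
qed

theorem theorem4:
  fixes A :: "('m::{t2_space, second_countable_topology}, 7) atlas"
    and \<omega> :: "'m tensor3"
    and \<xi> :: "'m vfield"
    and nabla :: "'m vfield \<Rightarrow> 'm vfield \<Rightarrow> 'm vfield"
  assumes "smooth_atlas A" and "oriented_atlas A"
    and "g2_star_structure A \<omega>"
    and "vector_field A \<xi>" and "\<forall>p. g43 A \<omega> p (\<xi> p) (\<xi> p) = - 1"
    and "levi_civita A (apm_g A \<omega>) nabla"
    and "\<forall>X. vector_field A X \<longrightarrow> nabla X \<xi> = (\<lambda>p. tv_zero)"
  shows "\<forall>X Y Z p. vector_field A X \<longrightarrow> vector_field A Y \<longrightarrow> vector_field A Z \<longrightarrow>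
           apm_F_W2 A \<omega> \<xi> nabla X Y Z p = 0"
proof (intro allI impI)
  fix X Y Z p
  assume "vector_field A X" "vector_field A Y" "vector_field A Z"
  then have T: "X q \<in> tangent_space A q" "Y q \<in> tangent_space A q" "Z q \<in> tangent_space A q" for q
    by (auto simp: vector_field_def)
  note tangent = apm_phi_in_tangent_space[OF assms(3,4)]
  show "apm_F_W2 A \<omega> \<xi> nabla X Y Z p = 0"
    using assms(7) unfolding apm_F_W2_def Let_def
    \<comment> \<open>The previous lemma is applied to \<phi>^2 X paired with \<phi>^2 Z and with
      \<phi>^2 Y; these fields are pointwise tangent by applying \<open>tangent\<close>
      twice.\<close>
    by (simp add: apm_F_xi_right[OF assms(3,4,6)] tangent T)
qed

end
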